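(* Let $I\subset\mathbb{R}$ be an open interval and let $\psi:I\to E^3$ be a smooth unit speed curve whose curvature $\kappa$ is a non-zero constant and whose torsion $\tau$ is non-constant. Then $\psi$ is a slant helix according to the modified orthogonal frame if and only if the function $$\frac{\tau'}{\left(\kappa^2+\tau^2\right)^{3/2}}$$ is constant on $I$.
   Context: $E^3$ is Euclidean 3-space with standard inner product $\langle\cdot,\cdot\rangle$; primes denote derivatives with respect to arc length $s$. The modified orthogonal frame of a unit speed curve $\psi$ is $T=\psi'$, $N=T'=\psi''$, $B=T\times N$; in terms of the Frenet frame $\{\mathbf t,\mathbf n,\mathbf b\}$ one has $T=\mathbf t$, $N=\kappa\mathbf n$, $B=\kappa\mathbf b$. The curve $\psi$ is a slant helix according to the modified orthogonal frame if its normal vector makes a constant angle with a fixed direction, i.e. there is a nonzero constant vector $U$ such that $\langle N(s),U\rangle$ is constant in $s$. *)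

theory Defs
  imports "HOL-Analysis.Analysis"
begin

text \<open>
  A curve \<open>\<psi> : I \<rightarrow> E\<^sup>3\<close> is a total function \<open>real \<Rightarrow> real^3\<close> whose values outside the open
  interval \<open>I\<close> are irrelevant: all derivatives below are taken at points of the open set \<open>I\<close>.
\<close>

definition cderiv :: "(real \<Rightarrow> 'a::real_normed_vector) \<Rightarrow> real \<Rightarrow> 'a" where
  "cderiv f s = vector_derivative f (at s)"

definition smooth_curve_on :: "real set \<Rightarrow> (real \<Rightarrow> 'a::real_normed_vector) \<Rightarrow> bool" where
  "smooth_curve_on I f \<longleftrightarrow> (\<forall>k. \<forall>s\<in>I. (cderiv ^^ k) f differentiable (at s))"

definition mof_T :: "(real \<Rightarrow> real^3) \<Rightarrow> real \<Rightarrow> real^3" where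
  "mof_T \<psi> = cderiv \<psi>"

definition mof_N :: "(real \<Rightarrow> real^3) \<Rightarrow> real \<Rightarrow> real^3" where
  "mof_N \<psi> = cderiv (mof_T \<psi>)"

definition mof_B :: "(real \<Rightarrow> real^3) \<Rightarrow> real \<Rightarrow> real^3" where
  "mof_B \<psi> s = cross3 (mof_T \<psi> s) (mof_N \<psi> s)"

definition unit_speed_on :: "real set \<Rightarrow> (real \<Rightarrow> real^3) \<Rightarrow> bool" where
  "unit_speed_on I \<psi> \<longleftrightarrow> (\<forall>s\<in>I. norm (cderiv \<psi> s) = 1)"

text \<open>
  Frenet apparatus of a unit speed curve. The torsion has the sign for which the Frenet equations
  read \<open>t' = \<kappa> n\<close>, \<open>n' = - \<kappa> t + \<tau> b\<close>, \<open>b' = - \<tau> n\<close>. The normal, binormal and torsion are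
  meaningful only where the curvature does not vanish.
\<close>

definition frenet_t :: "(real \<Rightarrow> real^3) \<Rightarrow> real \<Rightarrow> real^3" where
  "frenet_t \<psi> = cderiv \<psi>"

definition curvature :: "(real \<Rightarrow> real^3) \<Rightarrow> real \<Rightarrow> real" where
  "curvature \<psi> s = norm (cderiv (frenet_t \<psi>) s)"

definition frenet_n :: "(real \<Rightarrow> real^3) \<Rightarrow> real \<Rightarrow> real^3" where
  "frenet_n \<psi> s = cderiv (frenet_t \<psi>) s /\<^sub>R curvature \<psi> s"

definition frenet_b :: "(real \<Rightarrow> real^3) \<Rightarrow> real \<Rightarrow> real^3" where
  "frenet_b \<psi> s = cross3 (frenet_t \<psi> s) (frenet_n \<psi> s)"

definition torsion :: "(real \<Rightarrow> real^3) \<Rightarrow> real \<Rightarrow> real" where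
  "torsion \<psi> s = - (cderiv (frenet_b \<psi>) s \<bullet> frenet_n \<psi> s)"

lemma modified_frame_frenet:
  assumes "curvature \<psi> s \<noteq> 0"
  shows "mof_T \<psi> s = frenet_t \<psi> s"
    and "mof_N \<psi> s = curvature \<psi> s *\<^sub>R frenet_n \<psi> s"
    and "mof_B \<psi> s = curvature \<psi> s *\<^sub>R frenet_b \<psi> s"
  using assms
  by (simp_all add: mof_T_def mof_N_def mof_B_def frenet_t_def frenet_n_def frenet_b_def cross_mult_right)

definition slant_helix_mof_on :: "real set \<Rightarrow> (real \<Rightarrow> real^3) \<Rightarrow> bool" where
  "slant_helix_mof_on I \<psi> \<longleftrightarrow> (\<exists>U. U \<noteq> 0 \<and> (\<lambda>s. mof_N \<psi> s \<bullet> U) constant_on I)"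

end

theory Submission
  imports Defs
begin

text \<open>
  Since \<open>N = \<kappa> n\<close> with \<open>\<kappa>\<close> constant, the slant condition says that \<open>a = \<langle>n, U\<rangle>\<close> is constant. With
  \<open>f = \<langle>t, U\<rangle>\<close>, \<open>g = \<langle>b, U\<rangle>\<close> and \<open>w = sqrt (\<kappa>\<^sup>2 + \<tau>\<^sup>2)\<close>, the Frenet equations give \<open>\<tau> g = \<kappa> f\<close>, hence
  by differentiation \<open>\<tau>' g = a w\<^sup>2\<close>, and this makes \<open>g w\<close> a constant \<open>C\<close>. If \<open>C\<close> were zero, then \<open>f\<close>,
  \<open>g\<close> and \<open>a\<close> would all vanish and \<open>U = 0\<close>; therefore \<open>\<tau>' / w\<^sup>3 = a / C\<close>. Conversely, if
  \<open>\<tau>' / w\<^sup>3 = m\<close>, then \<open>(\<tau> / w) t + m \<kappa> n + (\<kappa> / w) b\<close> is a constant nonzero axis.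
\<close>

section \<open>Orthonormal frames built from the cross product\<close>

unbundle cross3_syntax

lemma bounded_bilinear_cross3: "bounded_bilinear cross3"
  using bilinear_cross bilinear_conv_bounded_bilinear by blast

lemmas has_vector_derivative_inner = bounded_bilinear.has_vector_derivative[OF bounded_bilinear_inner]
lemmas has_vector_derivative_cross3 = bounded_bilinear.has_vector_derivative[OF bounded_bilinear_cross3]

lemma cross3_frame:
  fixes t n :: "real^3"
  assumes "norm t = 1" "norm n = 1" "t \<bullet> n = 0"
  shows "(t \<times> n) \<times> t = n" "n \<times> (t \<times> n) = t"
    and "norm (t \<times> n) = 1"
proof -
  have "(t \<times> n) \<times> t = (t \<bullet> t) *\<^sub>R n - (t \<bullet> n) *\<^sub>R t"
    using exhaust_3 by (force simp: cross3_simps)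
  then show "(t \<times> n) \<times> t = n"
    using assms by (simp add: norm_eq_1)
  have "n \<times> (t \<times> n) = (n \<bullet> n) *\<^sub>R t - (t \<bullet> n) *\<^sub>R n"
    using exhaust_3 by (force simp: cross3_simps)
  then show "n \<times> (t \<times> n) = t"
    using assms by (simp add: norm_eq_1)
  show "norm (t \<times> n) = 1"
    using norm_cross_dot[of t n] assms by (simp add: power2_eq_1_iff) (smt (verit) norm_ge_zero)
qed

text \<open>Evaluate b x (b x x) for b = t x n in two ways. The triple product identity gives (b.x)
  b - x. Expanding b x x = (t.x) n - (n.x) t first, and using b x n = -t and b x t = n, gives -(t.x)
  t - (n.x) n.\<close>

lemma orthonormal_frame_expansion:
  fixes t n x :: "real^3"
  assumes "norm t = 1" "norm n = 1" "t \<bullet> n = 0"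
  shows "x = (x \<bullet> t) *\<^sub>R t + (x \<bullet> n) *\<^sub>R n + (x \<bullet> (t \<times> n)) *\<^sub>R (t \<times> n)"
proof -
  let ?b = "t \<times> n"
  have "?b \<times> (?b \<times> x) = (?b \<bullet> x) *\<^sub>R ?b - (?b \<bullet> ?b) *\<^sub>R x"
    using exhaust_3 by (force simp: cross3_simps)
  moreover have "?b \<times> x = (t \<bullet> x) *\<^sub>R n - (n \<bullet> x) *\<^sub>R t"
    using exhaust_3 by (force simp: cross3_simps)
  moreover have "?b \<bullet> ?b = 1"
    using cross3_frame(3)[OF assms] by (simp add: norm_eq_1)
  moreover have "?b \<times> n = - t"
    using cross3_frame(2)[OF assms] cross_skew[of ?b n] by simp
  ultimately have "(t \<bullet> x) *\<^sub>R - t - (n \<bullet> x) *\<^sub>R n = (?b \<bullet> x) *\<^sub>R ?b - x"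
    using cross3_frame(1)[OF assms]
    by (simp add: Cross3.right_diff_distrib cross_mult_right del: scaleR_minus_right)
  then show ?thesis
    by (simp add: inner_commute algebra_simps)
qed

text \<open>Serves to differentiate identities known only on \<open>I\<close>: as \<open>I\<close>
  is open, the function agrees with a constant near \<open>s\<close>, and derivatives are
  unique.\<close>

lemma has_vector_derivative_constant_imp_zero:
  assumes "open I" "s \<in> I" "f constant_on I" "(f has_vector_derivative d) (at s)"
  shows "d = 0"
proof -
  obtain c where "\<And>x. x \<in> I \<Longrightarrow> f x = c"
    using assms(3) by (auto simp: constant_on_def)
  then have "((\<lambda>_. c) has_vector_derivative d) (at s)"
    using has_vector_derivative_transform_within_open[OF assms(4,1,2)] by metis
  then show ?thesis
    using vector_derivative_unique_at has_vector_derivative_const by blast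
qed

lemma zero_derivative_imp_constant_on:
  fixes f :: "real \<Rightarrow> 'a::real_normed_vector"
  assumes "is_interval I" "\<And>s. s \<in> I \<Longrightarrow> (f has_vector_derivative 0) (at s)"
  shows "f constant_on I"
  using has_vector_derivative_zero_constant[of I f] assms
  unfolding constant_on_def
  by (metis has_vector_derivative_at_within is_interval_convex)

section \<open>Frenet equations for a curve with nowhere vanishing curvature\<close>

locale frenet_curve =
  fixes I :: "real set" and \<psi> :: "real \<Rightarrow> real^3"
  assumes open_I: "open I"
    and smooth: "smooth_curve_on I \<psi>"
    and unit_speed: "unit_speed_on I \<psi>"
    and curvature_nz: "s \<in> I \<Longrightarrow> curvature \<psi> s \<noteq> 0"
begin

text \<open>\<open>cderiv\<close> is total and has a default value where no derivative exists;
  smoothness makes its iterates genuine derivatives on \<open>I\<close>.\<close>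

lemma smooth_deriv:
  assumes "s \<in> I"
  shows "((cderiv ^^ k) \<psi> has_vector_derivative (cderiv ^^ Suc k) \<psi> s) (at s)"
proof -
  have "(cderiv ^^ k) \<psi> differentiable (at s)"
    using smooth assms by (simp add: smooth_curve_on_def)
  then show ?thesis
    by (simp add: cderiv_def vector_derivative_works)
qed

lemma deriv_t:
  assumes "s \<in> I"
  shows "(frenet_t \<psi> has_vector_derivative curvature \<psi> s *\<^sub>R frenet_n \<psi> s) (at s)"
  using smooth_deriv[OF assms, of 1] curvature_nz[OF assms]
  by (simp add: frenet_t_def frenet_n_def)

lemma norm_t: "s \<in> I \<Longrightarrow> norm (frenet_t \<psi> s) = 1"
  using unit_speed by (simp add: unit_speed_on_def frenet_t_def)

lemma norm_n: "s \<in> I \<Longrightarrow> norm (frenet_n \<psi> s) = 1"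
  using curvature_nz[of s] by (simp add: frenet_n_def curvature_def)

text \<open>Differentiating <t, t> = 1 gives 2 \<kappa> <t, n> = 0, and \<kappa> can be
  cancelled.\<close>

lemma t_inner_n:
  assumes "s \<in> I"
  shows "frenet_t \<psi> s \<bullet> frenet_n \<psi> s = 0"
proof -
  have "(\<lambda>s. frenet_t \<psi> s \<bullet> frenet_t \<psi> s) constant_on I"
    using norm_t by (auto simp: constant_on_def norm_eq_1)
  from has_vector_derivative_constant_imp_zero[OF open_I assms this
      has_vector_derivative_inner[OF deriv_t deriv_t]] assms
  show ?thesis
    using curvature_nz[OF assms] by (simp add: inner_commute)
qed

lemma frame:
  assumes "s \<in> I"
  shows "norm (frenet_t \<psi> s) = 1" "norm (frenet_n \<psi> s) = 1" "frenet_t \<psi> s \<bullet> frenet_n \<psi> s = 0"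
  using assms norm_t norm_n t_inner_n by auto

text \<open>The curvature is the norm of the second derivative, and the norm is differentiable away
  from the origin.\<close>

lemma inverse_curvature_differentiable:
  assumes "s \<in> I"
  shows "(\<lambda>s. inverse (curvature \<psi> s)) differentiable (at s)"
proof -
  have "(cderiv ^^ 2) \<psi> s \<noteq> 0"
    using curvature_nz[OF assms] by (auto simp: curvature_def frenet_t_def numeral_2_eq_2)
  moreover have "(cderiv ^^ 2) \<psi> differentiable (at s)"
    using smooth assms by (simp only: smooth_curve_on_def)
  ultimately have "(\<lambda>s. norm ((cderiv ^^ 2) \<psi> s)) differentiable (at s)"
    by (rule differentiable_compose[OF differentiable_norm_at])
  moreover have "(\<lambda>s. norm ((cderiv ^^ 2) \<psi> s)) = curvature \<psi>"
    by (simp add: fun_eq_iff curvature_def frenet_t_def numeral_2_eq_2)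
  ultimately show ?thesis
    using curvature_nz[OF assms] by (intro differentiable_inverse) auto
qed

text \<open>Product rule for n = \<psi>'' / \<kappa>; the term (1/\<kappa>)' \<psi>'' is a multiple
  of n. Its coefficient can stay unspecified, since it disappears on pairing with b.\<close>

lemma n_has_vector_derivative:
  assumes "s \<in> I"
  obtains d where "(frenet_n \<psi> has_vector_derivative
    inverse (curvature \<psi> s) *\<^sub>R (cderiv ^^ 3) \<psi> s + d *\<^sub>R frenet_n \<psi> s) (at s)"
proof -
  obtain e where e: "((\<lambda>s. inverse (curvature \<psi> s)) has_real_derivative e) (at s)"
    using inverse_curvature_differentiable[OF assms] real_differentiableE by blast
  have n: "frenet_n \<psi> = (\<lambda>s. inverse (curvature \<psi> s) *\<^sub>R (cderiv ^^ 2) \<psi> s)"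
    by (simp add: fun_eq_iff frenet_n_def frenet_t_def numeral_2_eq_2)
  have "(frenet_n \<psi> has_vector_derivative
    inverse (curvature \<psi> s) *\<^sub>R (cderiv ^^ 3) \<psi> s + (e * curvature \<psi> s) *\<^sub>R frenet_n \<psi> s) (at s)"
    using has_vector_derivative_scaleR[OF e smooth_deriv[OF assms, of 2]] curvature_nz[OF assms]
    unfolding n by (simp add: numeral_3_eq_3 numeral_2_eq_2 mult.assoc)
  then show thesis by (rule that)
qed

text \<open>In (t x n)' the term t' x n vanishes because t' is parallel to n.\<close>

lemma deriv_b_cross:
  assumes "s \<in> I" and n: "(frenet_n \<psi> has_vector_derivative n') (at s)"
  shows "(frenet_b \<psi> has_vector_derivative frenet_t \<psi> s \<times> n') (at s)"
  using has_vector_derivative_cross3[OF deriv_t[OF assms(1)] n]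
  by (simp add: frenet_b_def[abs_def] cross_mult_left)

lemma torsion_eq:
  assumes "s \<in> I" and n: "(frenet_n \<psi> has_vector_derivative n') (at s)"
  shows "torsion \<psi> s = n' \<bullet> frenet_b \<psi> s"
proof -
  have "cderiv (frenet_b \<psi>) s = frenet_t \<psi> s \<times> n'"
    using deriv_b_cross[OF assms] by (simp add: cderiv_def vector_derivative_at)
  then show ?thesis
    by (simp add: torsion_def frenet_b_def) (simp add: cross3_simps)
qed

text \<open>The frame components of n' are found separately: <n, n> = 1 kills the n-component, <t,
  n> = 0 makes the t-component -\<kappa>, and the b-component is the torsion by
  \<open>torsion_eq\<close>.\<close>

lemma deriv_n:
  assumes "s \<in> I"
  shows "(frenet_n \<psi> has_vector_derivative
    torsion \<psi> s *\<^sub>R frenet_b \<psi> s - curvature \<psi> s *\<^sub>R frenet_t \<psi> s) (at s)"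
proof -
  obtain n' where n': "(frenet_n \<psi> has_vector_derivative n') (at s)"
    using n_has_vector_derivative[OF assms] by blast
  have "(\<lambda>s. frenet_n \<psi> s \<bullet> frenet_n \<psi> s) constant_on I"
    using norm_n by (auto simp: constant_on_def norm_eq_1)
  from has_vector_derivative_constant_imp_zero[OF open_I assms this
      has_vector_derivative_inner[OF n' n']]
  have 1: "n' \<bullet> frenet_n \<psi> s = 0" by (simp add: inner_commute)
  have "(\<lambda>s. frenet_t \<psi> s \<bullet> frenet_n \<psi> s) constant_on I"
    using t_inner_n by (auto simp: constant_on_def)
  from has_vector_derivative_constant_imp_zero[OF open_I assms this
      has_vector_derivative_inner[OF deriv_t[OF assms] n']]
  have 2: "n' \<bullet> frenet_t \<psi> s = - curvature \<psi> s"
    using norm_n[OF assms] by (simp add: inner_commute norm_eq_1)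
  have "(n' \<bullet> frenet_t \<psi> s) *\<^sub>R frenet_t \<psi> s + (n' \<bullet> frenet_n \<psi> s) *\<^sub>R frenet_n \<psi> s
      + (n' \<bullet> frenet_b \<psi> s) *\<^sub>R frenet_b \<psi> s = n'"
    using orthonormal_frame_expansion[OF frame[OF assms], of n', symmetric]
    by (simp only: frenet_b_def)
  then have "torsion \<psi> s *\<^sub>R frenet_b \<psi> s - curvature \<psi> s *\<^sub>R frenet_t \<psi> s = n'"
    unfolding 1 2 torsion_eq[OF assms n', symmetric] by simp
  with n' show ?thesis by simp
qed

lemma deriv_b:
  assumes "s \<in> I"
  shows "(frenet_b \<psi> has_vector_derivative - torsion \<psi> s *\<^sub>R frenet_n \<psi> s) (at s)"
proof -
  have "frenet_t \<psi> s \<times> frenet_b \<psi> s = - frenet_n \<psi> s"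
    by (subst cross_skew) (simp only: frenet_b_def cross3_frame(1)[OF frame[OF assms]])
  then have "frenet_t \<psi> s \<times> (torsion \<psi> s *\<^sub>R frenet_b \<psi> s - curvature \<psi> s *\<^sub>R frenet_t \<psi> s)
      = - torsion \<psi> s *\<^sub>R frenet_n \<psi> s"
    by (simp add: Cross3.right_diff_distrib cross_mult_right)
  with deriv_b_cross[OF assms deriv_n[OF assms]] show ?thesis by simp
qed

text \<open>The definition of torsion contains a derivative of b, so its differentiability is not
  immediate. On \<open>I\<close> it equals <\<psi>''', b> / \<kappa>, whose factors are all
  differentiable.\<close>

lemma deriv_torsion:
  assumes "s \<in> I"
  shows "(torsion \<psi> has_real_derivative deriv (torsion \<psi>) s) (at s)"
proof -
  let ?f = "\<lambda>s. (inverse (curvature \<psi> s) *\<^sub>R (cderiv ^^ 3) \<psi> s) \<bullet> frenet_b \<psi> s"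
  have eq: "?f x = torsion \<psi> x" if "x \<in> I" for x
  proof -
    obtain d where d: "(frenet_n \<psi> has_vector_derivative
        inverse (curvature \<psi> x) *\<^sub>R (cderiv ^^ 3) \<psi> x + d *\<^sub>R frenet_n \<psi> x) (at x)"
      by (rule n_has_vector_derivative[OF \<open>x \<in> I\<close>])
    show ?thesis
      using torsion_eq[OF \<open>x \<in> I\<close> d]
      by (simp add: inner_add_left frenet_b_def dot_cross_self)
  qed
  have "(cderiv ^^ 3) \<psi> differentiable (at s)"
    using smooth assms by (simp only: smooth_curve_on_def)
  moreover have "frenet_b \<psi> differentiable (at s)"
    using deriv_b[OF assms] by (rule differentiableI_vector)
  ultimately have "?f differentiable (at s)"
    using inverse_curvature_differentiable[OF assms] by (intro differentiable_inner differentiable_scaleR) auto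
  then obtain d where "(?f has_real_derivative d) (at s)"
    using real_differentiableE by blast
  then have "(torsion \<psi> has_real_derivative d) (at s)"
    by (rule has_field_derivative_transform_within_open[OF _ open_I assms]) (use eq in auto)
  then show ?thesis by (metis DERIV_imp_deriv)
qed

end

section \<open>Slant helices of constant curvature\<close>

theorem theorem3p7:
  fixes I :: "real set" and \<psi> :: "real \<Rightarrow> real^3"
  assumes "open I" and "is_interval I" and "I \<noteq> {}"
    and "smooth_curve_on I \<psi>"
    and "unit_speed_on I \<psi>"
    and "curvature \<psi> constant_on I"
    and "\<forall>s\<in>I. curvature \<psi> s \<noteq> 0"
    and "\<not> torsion \<psi> constant_on I"
  shows "slant_helix_mof_on I \<psi> \<longleftrightarrow>
    (\<lambda>s. deriv (torsion \<psi>) s / ((curvature \<psi> s)\<^sup>2 + (torsion \<psi> s)\<^sup>2) powr (3/2)) constant_on I"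
proof -
  interpret frenet_curve I \<psi>
    using assms by unfold_locales auto
  define t n b \<tau> where "t = frenet_t \<psi>" and "n = frenet_n \<psi>" and "b = frenet_b \<psi>"
    and "\<tau> = torsion \<psi>"
  obtain c where c: "\<And>s. s \<in> I \<Longrightarrow> curvature \<psi> s = c"
    using assms(6) by (auto simp: constant_on_def)
  \<comment> \<open>A base point at which \<open>c\<close>, the constant \<open>C\<close> and the
    axis \<open>U\<close> are shown to be nonzero.\<close>
  obtain s0 where s0: "s0 \<in> I" using assms(3) by auto
  have "c \<noteq> 0" using c[OF s0] curvature_nz[OF s0] by simp
  have dt: "(t has_vector_derivative c *\<^sub>R n s) (at s)"
    and dn: "(n has_vector_derivative \<tau> s *\<^sub>R b s - c *\<^sub>R t s) (at s)"
    and db: "(b has_vector_derivative - \<tau> s *\<^sub>R n s) (at s)"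
    and d\<tau>: "(\<tau> has_real_derivative deriv \<tau> s) (at s)" if "s \<in> I" for s
    using deriv_t deriv_n deriv_b deriv_torsion that c[OF that]
    unfolding t_def n_def b_def \<tau>_def by metis+
  define w where "w s = sqrt (c\<^sup>2 + \<tau> s ^ 2)" for s
  have w2: "w s ^ 2 = c\<^sup>2 + \<tau> s ^ 2" and w_pos: "w s > 0" for s
    using \<open>c \<noteq> 0\<close> by (auto simp: w_def add_pos_nonneg)
  have dw: "(w has_real_derivative \<tau> s * deriv \<tau> s / w s) (at s)" if "s \<in> I" for s
  proof -
    have "((\<lambda>s. c\<^sup>2 + \<tau> s ^ 2) has_real_derivative 2 * \<tau> s * deriv \<tau> s) (at s)"
      using d\<tau>[OF that] by (auto intro!: derivative_eq_intros)
    from DERIV_chain2[OF DERIV_real_sqrt this] w_pos[of s] show ?thesis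
      by (simp add: w_def[abs_def] field_simps)
  qed
  \<comment> \<open>The base equals w^2 with w > 0, so the real power turns into an ordinary
    cube.\<close>
  have w3: "(c\<^sup>2 + \<tau> s ^ 2) powr (3/2) = w s ^ 3" for s
  proof -
    have "(w s ^ 2) powr (3/2) = w s powr 3"
      using w_pos[of s] by (simp add: powr_powr flip: powr_numeral)
    then show ?thesis using w_pos[of s] by (simp add: w2)
  qed
  have mof_N: "mof_N \<psi> s = c *\<^sub>R n s" if "s \<in> I" for s
    using modified_frame_frenet(2)[OF curvature_nz[OF that]] c[OF that] by (simp add: n_def)
  have expand: "(x \<bullet> t s) *\<^sub>R t s + (x \<bullet> n s) *\<^sub>R n s + (x \<bullet> b s) *\<^sub>R b s = x"
    if "s \<in> I" for s x
    using orthonormal_frame_expansion[OF frame[OF that], of x, symmetric]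
    by (simp only: t_def n_def b_def frenet_b_def)
  have rhs: "(\<lambda>s. deriv (torsion \<psi>) s / ((curvature \<psi> s)\<^sup>2 + (torsion \<psi> s)\<^sup>2) powr (3/2)) constant_on I
      \<longleftrightarrow> (\<lambda>s. deriv \<tau> s / w s ^ 3) constant_on I"
    using c w3 by (simp add: constant_on_def \<tau>_def)
  show ?thesis
    unfolding rhs
  proof

    \<comment> \<open>From an axis to the constant quotient\<close>
    assume "slant_helix_mof_on I \<psi>"
    then obtain U a' where "U \<noteq> 0" and a': "\<And>s. s \<in> I \<Longrightarrow> c * (n s \<bullet> U) = a'"
      using mof_N by (auto simp: slant_helix_mof_on_def constant_on_def)
    define a where "a = a' / c"
    have a: "n s \<bullet> U = a" if "s \<in> I" for s
      using a'[OF that] \<open>c \<noteq> 0\<close> by (simp add: a_def field_simps)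
    define f g where "f s = t s \<bullet> U" and "g s = b s \<bullet> U" for s
    have df: "(f has_vector_derivative c * a) (at s)"
      and dg: "(g has_vector_derivative - \<tau> s * a) (at s)" if "s \<in> I" for s
      using has_vector_derivative_inner[OF dt[OF that] has_vector_derivative_const[of U]]
        has_vector_derivative_inner[OF db[OF that] has_vector_derivative_const[of U]] a[OF that]
      by (simp_all add: f_def[abs_def] g_def[abs_def])
    have fg: "\<tau> s * g s = c * f s" if "s \<in> I" for s
    proof -
      have "(\<lambda>s. n s \<bullet> U) constant_on I"
        using a by (auto simp: constant_on_def)
      from has_vector_derivative_constant_imp_zero[OF open_I that this
          has_vector_derivative_inner[OF dn[OF that] has_vector_derivative_const]]
      show ?thesis by (simp add: f_def g_def inner_diff_left)
    qed
    \<comment> \<open>Differentiating \<tau> g = c f with f' = c a and g' = -\<tau> a gives \<tau>'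
      g - \<tau>^2 a = c^2 a.\<close>
    have key: "deriv \<tau> s * g s = a * w s ^ 2" if "s \<in> I" for s
    proof -
      have const: "(\<lambda>s. \<tau> s * g s - c * f s) constant_on I"
        using fg by (auto simp: constant_on_def)
      have "((\<lambda>s. \<tau> s * g s - c * f s) has_real_derivative
          (deriv \<tau> s * g s + - \<tau> s * a * \<tau> s) - c * (c * a)) (at s)"
        using df[OF that] dg[OF that] d\<tau>[OF that]
        by (auto intro!: derivative_eq_intros simp flip: has_real_derivative_iff_has_vector_derivative)
      from has_vector_derivative_constant_imp_zero[OF open_I that const
          this[unfolded has_real_derivative_iff_has_vector_derivative]]
      show ?thesis
        unfolding w2 by (simp add: algebra_simps power2_eq_square)
    qed
    \<comment> \<open>The two terms of the product rule are -\<tau> a w and \<tau> (\<tau>' g) / w;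
      by \<open>key\<close> the second equals \<tau> a w.\<close>
    have "((\<lambda>s. g s * w s) has_vector_derivative 0) (at s)" if "s \<in> I" for s
    proof -
      have "\<tau> s * deriv \<tau> s / w s * g s = \<tau> s * (deriv \<tau> s * g s) / w s" by simp
      also have "\<dots> = \<tau> s * a * w s"
        unfolding key[OF that] using w_pos[of s] by (simp add: power2_eq_square)
      finally have "- \<tau> s * a * w s + \<tau> s * deriv \<tau> s / w s * g s = 0" by simp
      moreover have "((\<lambda>s. g s * w s) has_real_derivative
          - \<tau> s * a * w s + \<tau> s * deriv \<tau> s / w s * g s) (at s)"
        using dg[OF that] dw[OF that]
        by (auto intro!: derivative_eq_intros simp flip: has_real_derivative_iff_has_vector_derivative)
      ultimately have "((\<lambda>s. g s * w s) has_real_derivative 0) (at s)"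
        by simp
      then show ?thesis
        by (simp add: has_real_derivative_iff_has_vector_derivative)
    qed
    from zero_derivative_imp_constant_on[OF assms(2) this]
    obtain C where C: "\<And>s. s \<in> I \<Longrightarrow> g s * w s = C"
      by (auto simp: constant_on_def)
    have "C \<noteq> 0"
    proof
      assume "C = 0"
      then have "g s0 = 0" using C[OF s0] w_pos[of s0] by simp
      moreover from this have "f s0 = 0" "a = 0"
        using fg[OF s0] key[OF s0] \<open>c \<noteq> 0\<close> w_pos[of s0] by simp_all
      ultimately have "U = 0"
        using expand[OF s0, of U] a[OF s0] by (simp add: f_def g_def inner_commute)
      with \<open>U \<noteq> 0\<close> show False by simp
    qed
    have "deriv \<tau> s / w s ^ 3 = a / C" if "s \<in> I" for s
    proof -
      have "deriv \<tau> s * C = deriv \<tau> s * g s * w s" using C[OF that] by simp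
      also have "\<dots> = a * w s ^ 3"
        unfolding key[OF that] by (simp add: power2_eq_square power3_eq_cube)
      finally show ?thesis using \<open>C \<noteq> 0\<close> w_pos[of s] by (simp add: field_simps)
    qed
    then show "(\<lambda>s. deriv \<tau> s / w s ^ 3) constant_on I"
      by (auto simp: constant_on_def)
  next

    \<comment> \<open>From the constant quotient to an axis\<close>
    assume "(\<lambda>s. deriv \<tau> s / w s ^ 3) constant_on I"
    then obtain m where m': "\<And>s. s \<in> I \<Longrightarrow> deriv \<tau> s / w s ^ 3 = m"
      by (auto simp: constant_on_def)
    have m: "deriv \<tau> s = m * w s ^ 3" if "s \<in> I" for s
      using m'[OF that] w_pos[of s] by (simp add: field_simps)
    \<comment> \<open>The coefficients are those forced in the other direction, namely f = \<tau> g
      / c, a = m C and g = C / w, with the scale fixed by C = c.\<close>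
    define V where "V s = (\<tau> s / w s) *\<^sub>R t s + (m * c) *\<^sub>R n s + (c / w s) *\<^sub>R b s" for s
    have "(V has_vector_derivative 0) (at s)" if "s \<in> I" for s
    proof -
      \<comment> \<open>With \<tau>' = m w^3, the quotient rule makes both derivatives free of w:
        (\<tau>/w)' = m (w^2 - \<tau>^2) = m c^2 and (c/w)' = -m c \<tau>.\<close>
      have "(deriv \<tau> s * w s - \<tau> s * (\<tau> s * deriv \<tau> s / w s)) / (w s * w s)
          = m * (w s ^ 2 - \<tau> s ^ 2)"
        using w_pos[of s] by (simp add: m[OF that] field_simps power2_eq_square power3_eq_cube)
      then have 1: "((\<lambda>s. \<tau> s / w s) has_real_derivative m * c\<^sup>2) (at s)"
        using DERIV_divide[OF d\<tau>[OF that] dw[OF that]] w_pos[of s] by (simp add: w2)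
      have "(0 * w s - c * (\<tau> s * deriv \<tau> s / w s)) / (w s * w s) = - m * c * \<tau> s"
        using w_pos[of s] by (simp add: m[OF that] field_simps power3_eq_cube)
      then have 2: "((\<lambda>s. c / w s) has_real_derivative - m * c * \<tau> s) (at s)"
        using DERIV_divide[OF DERIV_const dw[OF that]] w_pos[of s] by (metis less_irrefl)
      \<comment> \<open>The terms cancel in pairs: m c^2 against m c * c along t, c \<tau> / w
        against itself along n, and m c \<tau> against itself along b.\<close>
      have "(V has_vector_derivative
          ((\<tau> s / w s) *\<^sub>R c *\<^sub>R n s + (m * c\<^sup>2) *\<^sub>R t s)
          + (m * c) *\<^sub>R (\<tau> s *\<^sub>R b s - c *\<^sub>R t s)
          + ((c / w s) *\<^sub>R (- \<tau> s *\<^sub>R n s) + (- m * c * \<tau> s) *\<^sub>R b s)) (at s)"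
        unfolding V_def[abs_def]
        by (intro has_vector_derivative_add has_vector_derivative_scaleR 1 2 dt dn db that
          bounded_linear.has_vector_derivative[OF bounded_linear_scaleR_right])
      then show ?thesis
        by (simp add: algebra_simps power2_eq_square)
    qed
    from zero_derivative_imp_constant_on[OF assms(2) this]
    obtain U where U: "\<And>s. s \<in> I \<Longrightarrow> V s = U"
      by (auto simp: constant_on_def)
    have ortho: "t s \<bullet> b s = 0" "n s \<bullet> b s = 0" "n s \<bullet> t s = 0" "n s \<bullet> n s = 1" "b s \<bullet> b s = 1"
      if "s \<in> I" for s
      using frame[OF that] cross3_frame(3)[OF frame[OF that]]
      by (simp_all add: t_def n_def b_def frenet_b_def dot_cross_self inner_commute norm_eq_1)
    \<comment> \<open>The b-component of the axis never vanishes, whatever the value of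
      \<open>m\<close>, so the axis is nonzero even for m = 0.\<close>
    have "U \<bullet> b s0 = c / w s0"
      using ortho[OF s0] by (simp add: V_def inner_add_left flip: U[OF s0])
    then have "U \<noteq> 0" using \<open>c \<noteq> 0\<close> w_pos[of s0] by auto
    moreover have "mof_N \<psi> s \<bullet> U = m * c\<^sup>2" if "s \<in> I" for s
      using ortho[OF that] mof_N[OF that]
      by (simp add: V_def inner_add_right power2_eq_square flip: U[OF that])
    ultimately show "slant_helix_mof_on I \<psi>"
      by (auto simp: slant_helix_mof_on_def constant_on_def)
  qed
qed

end
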